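(* Let $X\ne\{0\}$ be a real normed space with norm $\|\cdot\|$. Let $b:X\to(-\infty,\infty]$ be convex and assume that $U:=\mathrm{Int}(\mathrm{dom}(b))\ne\emptyset$. Suppose further that $b$ is continuous on $\mathrm{dom}(b)$ and twice continuously Fréchet differentiable in $U$. Then: (I) Given $x,y\in U$, suppose that $$\eta[x,y]:=\inf\{b''(z)(w,w):z\in[x,y],\ w\in X,\ \|w\|=1\}>0.$$ Then $b$ is strongly convex on $[x,y]$ with strong convexity parameter $\mu:=\eta[x,y]$. (II) Given a nonempty and convex subset $S$ of $U$, if $$\eta[S]:=\inf\{b''(z)(w,w):z\in S,\ w\in X,\ \|w\|=1\}>0,$$ then $b$ is strongly convex on $S$ with strong convexity parameter $\mu:=\eta[S]$. Moreover, $b$ is strongly convex on $\overline S\cap\mathrm{dom}(b)$ with the same strong convexity parameter $\eta[S]$. (III) If $\eta[S]>0$ for each nonempty, bounded and convex subset $S$ of $U$, then $b$ is strongly convex on each of these subsets and, moreover, strongly convex also on each nonempty, bounded and convex subset of $\mathrm{dom}(b)$.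
   Context: $\mathrm{dom}(b):=\{x\in X:b(x)<\infty\}$; $[x,y]:=\{tx+(1-t)y:t\in[0,1]\}$; $b''(z):X^2\to\mathbb R$ is the second Fréchet derivative, viewed as a continuous bilinear form. For a convex $b$ and a nonempty subset $S\subseteq\mathrm{dom}(b)$, $b$ is strongly convex on $S$ with strong convexity parameter $\mu>0$ if for all $x,y\in S$ and $\lambda\in(0,1)$: $b(\lambda x+(1-\lambda)y)+\tfrac12\mu\lambda(1-\lambda)\|x-y\|^2\le\lambda b(x)+(1-\lambda)b(y)$; it is strongly convex on $S$ if this holds for some $\mu>0$ (depending on $S$). *)

theory Defs
  imports "HOL-Analysis.Analysis"
begin

definition eff_dom :: "('a \<Rightarrow> ereal) \<Rightarrow> 'a set" where
  "eff_dom b = {x. b x < \<infinity>}"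

(* The library's convex_on covers real-valued functions only.  For b with values in
   (-infinity, infinity] no indeterminate sum occurs on the right-hand side. *)
definition ereal_convex :: "('a::real_vector \<Rightarrow> ereal) \<Rightarrow> bool" where
  "ereal_convex b \<longleftrightarrow>
     (\<forall>x y. \<forall>l\<in>{0<..<1::real}.
        b (l *\<^sub>R x + (1 - l) *\<^sub>R y) \<le> ereal l * b x + ereal (1 - l) * b y)"

definition strongly_convex_on_with ::
    "'a::real_normed_vector set \<Rightarrow> ('a \<Rightarrow> ereal) \<Rightarrow> real \<Rightarrow> bool" where
  "strongly_convex_on_with S b \<mu> \<longleftrightarrow>
     S \<noteq> {} \<and> S \<subseteq> eff_dom b \<and> \<mu> > 0 \<and>
     (\<forall>x\<in>S. \<forall>y\<in>S. \<forall>l\<in>{0<..<1::real}.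
        b (l *\<^sub>R x + (1 - l) *\<^sub>R y) + ereal (1/2 * \<mu> * l * (1 - l) * (norm (x - y))\<^sup>2)
          \<le> ereal l * b x + ereal (1 - l) * b y)"

definition strongly_convex_on :: "'a::real_normed_vector set \<Rightarrow> ('a \<Rightarrow> ereal) \<Rightarrow> bool" where
  "strongly_convex_on S b \<longleftrightarrow> (\<exists>\<mu>. strongly_convex_on_with S b \<mu>)"

(* The library's frechet_derivative, packaged as an element of the normed space of bounded
   linear maps, so that it can be differentiated again.  Meaningful only where f is
   differentiable. *)
definition fderiv ::
    "('a::real_normed_vector \<Rightarrow> 'b::real_normed_vector) \<Rightarrow> 'a \<Rightarrow> 'a \<Rightarrow>\<^sub>L 'b" where
  "fderiv f x = Blinfun (frechet_derivative f (at x))"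

(* fderiv2 f z v w is f''(z)(v, w), under the usual identification of
   L(X, L(X, Y)) with the continuous bilinear maps X x X -> Y. *)
definition fderiv2 ::
    "('a::real_normed_vector \<Rightarrow> 'b::real_normed_vector) \<Rightarrow> 'a \<Rightarrow> 'a \<Rightarrow>\<^sub>L 'a \<Rightarrow>\<^sub>L 'b" where
  "fderiv2 f = fderiv (fderiv f)"

(* Intended for open U, where the derivatives at points of U depend on f restricted to U only. *)
definition twice_cont_fdiff_on ::
    "('a::real_normed_vector \<Rightarrow> 'b::real_normed_vector) \<Rightarrow> 'a set \<Rightarrow> bool" where
  "twice_cont_fdiff_on f U \<longleftrightarrow>
     (\<forall>x\<in>U. f differentiable (at x)) \<and>
     (\<forall>x\<in>U. fderiv f differentiable (at x)) \<and>
     continuous_on U (fderiv2 f)"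

(* b is finite on eff_dom b, so real_of_ereal does not change it there.  The infimum is a real
   one: for convex b and nonempty S inside the interior of eff_dom b, the set is bounded below
   by 0, and it is nonempty since the space is nontrivial. *)
definition eta :: "('a::real_normed_vector \<Rightarrow> ereal) \<Rightarrow> 'a set \<Rightarrow> real" where
  "eta b S = Inf {fderiv2 (\<lambda>x. real_of_ereal (b x)) z w w | z w. z \<in> S \<and> norm w = 1}"

end

theory Submission
  imports Defs
begin

text \<open>
  Write \<open>f\<close> for the real-valued restriction of \<open>b\<close> to its effective domain, a convex function.

  The substance is one-dimensional. Restricting \<open>f\<close> to the line
  \<open>t \<mapsto> y + t (x - y)\<close> turns a lower bound \<open>f'' \<ge> \<mu>\<close> along the segment into
  the convexity of \<open>t \<mapsto> f (y + t (x - y)) - \<mu>/2 * \<parallel>x - y\<parallel>\<^sup>2 * t\<^sup>2\<close> on \<open>[0, 1]\<close>, and the convexity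
  inequality of this function between \<open>0\<close> and \<open>1\<close> is exactly the strong convexity inequality
  (\<open>fderiv2_ge_imp_strong_convexity_ineq\<close>). The bound \<open>f''(z)(w, w) \<ge> \<mu> \<parallel>w\<parallel>\<^sup>2\<close> with \<open>\<mu> = \<eta>[S]\<close>
  follows from the definition of \<open>\<eta>\<close> by scaling \<open>w\<close>, once the set whose infimum is taken is known to be
  bounded below: convexity gives \<open>f'' \<ge> 0\<close> (\<open>convex_imp_fderiv2_nonneg\<close>). This settles every convex
  subset of \<open>U\<close>, a segment between points of \<open>U\<close> being such a subset.

  Continuity of \<open>f\<close> on its domain carries the inequality over to the part of the closure of \<open>S\<close> that
  lies in the domain (\<open>strongly_convex_on_with_closure\<close>). For the last claim, a bounded subset of the
  domain lies in the closure of \<open>U \<inter> ball 0 R\<close> for large \<open>R\<close>: the open segment from a point of the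
  domain to a point of \<open>U\<close> stays in \<open>U\<close>. Hence the closure result for the bounded convex set
  \<open>U \<inter> ball 0 R\<close> applies.
\<close>

section \<open>Convex functions with extended real values\<close>

lemma convex_eff_dom:
  fixes b :: "'a::real_normed_vector \<Rightarrow> ereal"
  assumes "ereal_convex b"
  shows "convex (eff_dom b)"
  unfolding convex_alt
proof (intro ballI allI impI)
  fix x y and u :: real
  assume xy: "x \<in> eff_dom b" "y \<in> eff_dom b" and u: "0 \<le> u \<and> u \<le> 1"
  show "(1 - u) *\<^sub>R x + u *\<^sub>R y \<in> eff_dom b"
  proof (cases "u = 0 \<or> u = 1")
    case True
    with xy show ?thesis by auto
  next
    case False
    with u have u': "u \<in> {0<..<1}" by auto
    have "b (u *\<^sub>R y + (1 - u) *\<^sub>R x) \<le> ereal u * b y + ereal (1 - u) * b x"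
      using assms u' unfolding ereal_convex_def by blast
    also have "\<dots> < \<infinity>"
      using xy u' by (cases "b x"; cases "b y") (auto simp: eff_dom_def)
    finally show ?thesis by (simp add: eff_dom_def add.commute)
  qed
qed

lemma ereal_real_of_ereal_eff_dom:
  assumes "\<And>x. b x \<noteq> - \<infinity>" "x \<in> eff_dom b"
  shows "ereal (real_of_ereal (b x)) = b x"
  using assms(1)[of x] assms(2) by (auto simp: eff_dom_def ereal_real)

lemma convex_on_real_of_ereal:
  fixes b :: "'a::real_normed_vector \<Rightarrow> ereal"
  assumes proper: "\<And>x. b x \<noteq> - \<infinity>" and cvx: "ereal_convex b"
  shows "convex_on (eff_dom b) (\<lambda>x. real_of_ereal (b x))"
proof (rule convex_onI)
  show dom: "convex (eff_dom b)" by (rule convex_eff_dom[OF cvx])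
  fix t :: real and x y
  assume t: "t > 0" "t < 1" and xy: "x \<in> eff_dom b" "y \<in> eff_dom b"
  have z: "t *\<^sub>R y + (1 - t) *\<^sub>R x \<in> eff_dom b"
    using convexD_alt[OF dom xy, of t] t by (simp add: add.commute)
  have "b (t *\<^sub>R y + (1 - t) *\<^sub>R x) \<le> ereal t * b y + ereal (1 - t) * b x"
    using cvx t unfolding ereal_convex_def by auto
  then have "ereal (real_of_ereal (b (t *\<^sub>R y + (1 - t) *\<^sub>R x)))
      \<le> ereal t * ereal (real_of_ereal (b y)) + ereal (1 - t) * ereal (real_of_ereal (b x))"
    unfolding ereal_real_of_ereal_eff_dom[OF proper z] ereal_real_of_ereal_eff_dom[OF proper xy(1)]
      ereal_real_of_ereal_eff_dom[OF proper xy(2)] .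
  then show "real_of_ereal (b ((1 - t) *\<^sub>R x + t *\<^sub>R y))
      \<le> (1 - t) * real_of_ereal (b x) + t * real_of_ereal (b y)"
    by (simp add: add.commute)
qed

lemma strongly_convex_on_with_iff_real:
  fixes b :: "'a::real_normed_vector \<Rightarrow> ereal"
  assumes proper: "\<And>x. b x \<noteq> - \<infinity>" and cvx: "ereal_convex b"
    and S: "S \<noteq> {}" "S \<subseteq> eff_dom b"
  shows "strongly_convex_on_with S b \<mu> \<longleftrightarrow> \<mu> > 0 \<and>
    (\<forall>x\<in>S. \<forall>y\<in>S. \<forall>l\<in>{0<..<1}.
      real_of_ereal (b (l *\<^sub>R x + (1 - l) *\<^sub>R y)) + 1/2 * \<mu> * l * (1 - l) * (norm (x - y))\<^sup>2
        \<le> l * real_of_ereal (b x) + (1 - l) * real_of_ereal (b y))"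
proof -
  have "b (l *\<^sub>R x + (1 - l) *\<^sub>R y) + ereal (1/2 * \<mu> * l * (1 - l) * (norm (x - y))\<^sup>2)
          \<le> ereal l * b x + ereal (1 - l) * b y \<longleftrightarrow>
      real_of_ereal (b (l *\<^sub>R x + (1 - l) *\<^sub>R y)) + 1/2 * \<mu> * l * (1 - l) * (norm (x - y))\<^sup>2
        \<le> l * real_of_ereal (b x) + (1 - l) * real_of_ereal (b y)"
    (is "?E \<longleftrightarrow> ?R")
    if "x \<in> S" "y \<in> S" and l: "l \<in> {0<..<1}" for x y and l :: real
  proof -
    have x: "x \<in> eff_dom b" and y: "y \<in> eff_dom b" using that S by auto
    have z: "l *\<^sub>R x + (1 - l) *\<^sub>R y \<in> eff_dom b"
      using convexD_alt[OF convex_eff_dom[OF cvx] y x, of l] l by (simp add: add.commute)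
    obtain p q r where pqr: "b x = ereal p" "b y = ereal q" "b (l *\<^sub>R x + (1 - l) *\<^sub>R y) = ereal r"
      using ereal_real_of_ereal_eff_dom[of b, OF proper] x y z by metis
    show ?thesis unfolding pqr by simp
  qed
  then show ?thesis using S unfolding strongly_convex_on_with_def by simp
qed

lemma strongly_convex_on_with_subset:
  assumes "strongly_convex_on_with T b \<mu>" "S \<subseteq> T" "S \<noteq> {}"
  shows "strongly_convex_on_with S b \<mu>"
  using assms unfolding strongly_convex_on_with_def by blast

text \<open>
  The strong convexity inequality at two limit points is the limit of the inequalities at the
  approximating points; their convex combinations converge inside the effective domain, where \<open>b\<close> is
  continuous and finite.
\<close>

lemma strongly_convex_on_with_closure:
  fixes b :: "'a::real_normed_vector \<Rightarrow> ereal"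
  assumes proper: "\<And>x. b x \<noteq> - \<infinity>" and cvx: "ereal_convex b"
    and cont: "continuous_on (eff_dom b) b"
    and S: "strongly_convex_on_with S b \<mu>"
  shows "strongly_convex_on_with (closure S \<inter> eff_dom b) b \<mu>"
proof -
  let ?f = "\<lambda>x. real_of_ereal (b x)" and ?D = "eff_dom b"
  have S_ne: "S \<noteq> {}" and SD: "S \<subseteq> ?D"
    using S unfolding strongly_convex_on_with_def by auto
  note real_S = S[unfolded strongly_convex_on_with_iff_real[OF proper cvx S_ne SD]]
  have contf: "continuous_on ?D ?f"
    using cont continuous_on_iff_real[of ?D b] proper by (auto simp: eff_dom_def o_def)
  have ne: "closure S \<inter> ?D \<noteq> {}" using S_ne SD closure_subset by fastforce
  show ?thesis
    unfolding strongly_convex_on_with_iff_real[OF proper cvx ne Int_lower2]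
  proof (intro conjI ballI)
    show "\<mu> > 0" using real_S by simp
    fix x y and l :: real
    assume x: "x \<in> closure S \<inter> ?D" and y: "y \<in> closure S \<inter> ?D" and l: "l \<in> {0<..<1}"
    obtain X where X: "\<And>n. X n \<in> S" "X \<longlonglongrightarrow> x"
      using x unfolding Int_iff closure_sequential by blast
    obtain Y where Y: "\<And>n. Y n \<in> S" "Y \<longlonglongrightarrow> y"
      using y unfolding Int_iff closure_sequential by blast
    have comb: "l *\<^sub>R p + (1 - l) *\<^sub>R q \<in> ?D" if "p \<in> ?D" "q \<in> ?D" for p q
      using convexD_alt[OF convex_eff_dom[OF cvx] that(2,1), of l] l by (simp add: add.commute)
    have lim: "(\<lambda>n. ?f (Z n)) \<longlonglongrightarrow> ?f z" if "Z \<longlonglongrightarrow> z" "z \<in> ?D" "\<And>n. Z n \<in> ?D" for Z z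
      using continuous_on_tendsto_compose[OF contf that(1,2)] that(3) by simp
    have Z: "(\<lambda>n. l *\<^sub>R X n + (1 - l) *\<^sub>R Y n) \<longlonglongrightarrow> l *\<^sub>R x + (1 - l) *\<^sub>R y"
      by (intro tendsto_intros X Y)
    show "?f (l *\<^sub>R x + (1 - l) *\<^sub>R y) + 1/2 * \<mu> * l * (1 - l) * (norm (x - y))\<^sup>2
        \<le> l * ?f x + (1 - l) * ?f y"
    proof (rule LIMSEQ_le)
      show "(\<lambda>n. ?f (l *\<^sub>R X n + (1 - l) *\<^sub>R Y n)
              + 1/2 * \<mu> * l * (1 - l) * (norm (X n - Y n))\<^sup>2)
          \<longlonglongrightarrow> ?f (l *\<^sub>R x + (1 - l) *\<^sub>R y) + 1/2 * \<mu> * l * (1 - l) * (norm (x - y))\<^sup>2"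
        by (intro tendsto_intros lim[OF Z] X Y comb) (use x y X Y SD in auto)
      show "(\<lambda>n. l * ?f (X n) + (1 - l) * ?f (Y n)) \<longlonglongrightarrow> l * ?f x + (1 - l) * ?f y"
        by (intro tendsto_intros lim X Y) (use x y X Y SD in auto)
      show "\<exists>N. \<forall>n\<ge>N. ?f (l *\<^sub>R X n + (1 - l) *\<^sub>R Y n)
              + 1/2 * \<mu> * l * (1 - l) * (norm (X n - Y n))\<^sup>2
            \<le> l * ?f (X n) + (1 - l) * ?f (Y n)"
        using real_S X(1) Y(1) l by blast
    qed
  qed
qed

section \<open>Second derivatives along lines\<close>

lemma has_derivative_fderiv:
  assumes "f differentiable (at x)"
  shows "(f has_derivative blinfun_apply (fderiv f x)) (at x)"
  using assms unfolding fderiv_def frechet_derivative_works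
  by (simp add: bounded_linear_Blinfun_apply has_derivative_bounded_linear)

lemma has_real_derivative_along_line:
  fixes f :: "'a::real_normed_vector \<Rightarrow> real"
  assumes "f differentiable (at (y + t *\<^sub>R v))"
  shows "((\<lambda>s. f (y + s *\<^sub>R v)) has_real_derivative fderiv f (y + t *\<^sub>R v) v) (at t)"
proof -
  have "((\<lambda>s. y + s *\<^sub>R v) has_derivative (\<lambda>s. s *\<^sub>R v)) (at t)"
    by (auto intro!: derivative_eq_intros)
  from has_derivative_compose[OF this has_derivative_fderiv[OF assms]]
  show ?thesis
    by (simp add: has_field_derivative_def blinfun.scaleR_right mult_commute_abs)
qed

lemma has_real_derivative_fderiv_along_line:
  fixes f :: "'a::real_normed_vector \<Rightarrow> real"
  assumes "fderiv f differentiable (at (y + t *\<^sub>R v))"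
  shows "((\<lambda>s. fderiv f (y + s *\<^sub>R v) v) has_real_derivative fderiv2 f (y + t *\<^sub>R v) v v) (at t)"
proof -
  have "((\<lambda>s. y + s *\<^sub>R v) has_derivative (\<lambda>s. s *\<^sub>R v)) (at t)"
    by (auto intro!: derivative_eq_intros)
  from has_derivative_compose[OF this has_derivative_fderiv[OF assms]]
  have "((\<lambda>s. fderiv f (y + s *\<^sub>R v)) has_derivative
      (\<lambda>s. fderiv2 f (y + t *\<^sub>R v) (s *\<^sub>R v))) (at t)"
    by (simp add: fderiv2_def)
  from bounded_linear.has_derivative[OF blinfun.bounded_linear_left[of v] this]
  show ?thesis
    by (simp add: has_field_derivative_def blinfun.scaleR_right blinfun.scaleR_left mult_commute_abs)
qed

text \<open>
  On a line through \<open>z\<close> the graph of the convex restriction lies above its tangents at \<open>0\<close> and at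
  \<open>h > 0\<close>; comparing the two tangents shows that the slope at \<open>h\<close> is at least the slope at \<open>0\<close>, which
  a negative second derivative at \<open>0\<close> would contradict for small \<open>h\<close>.
\<close>

lemma convex_imp_fderiv2_nonneg:
  fixes f :: "'a::real_normed_vector \<Rightarrow> real"
  assumes U: "open U" and cvx: "convex_on U f"
    and d1: "\<And>x. x \<in> U \<Longrightarrow> f differentiable (at x)"
    and d2: "fderiv f differentiable (at z)"
    and z: "z \<in> U"
  shows "0 \<le> fderiv2 f z w w"
proof (rule ccontr)
  let ?g = "\<lambda>s. f (z + s *\<^sub>R w)" and ?g' = "\<lambda>s. fderiv f (z + s *\<^sub>R w) w"
  define T where "T = (\<lambda>s. z + s *\<^sub>R w) -` U"
  assume "\<not> 0 \<le> fderiv2 f z w w"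
  then have neg: "fderiv2 f z w w < 0" by simp
  have line: "z + ((1 - u) * s + u * t) *\<^sub>R w
      = (1 - u) *\<^sub>R (z + s *\<^sub>R w) + u *\<^sub>R (z + t *\<^sub>R w)" for u s t
    by (simp add: algebra_simps)
  have openT: "open T" unfolding T_def
    by (intro open_vimage U continuous_intros)
  have convexT: "convex T"
    unfolding convex_alt T_def
    using convexD_alt[OF convex_on_imp_convex[OF cvx]] by (simp add: line)
  have convexg: "convex_on T ?g"
  proof (rule convex_onI[OF _ convexT])
    fix u s t :: real
    assume "0 < u" "u < 1" "s \<in> T" "t \<in> T"
    then show "?g ((1 - u) *\<^sub>R s + u *\<^sub>R t) \<le> (1 - u) * ?g s + u * ?g t"
      using convex_onD[OF cvx, of u "z + s *\<^sub>R w" "z + t *\<^sub>R w"] by (simp add: T_def line)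
  qed
  have tangent: "?g t - ?g s \<ge> ?g' s * (t - s)" if "s \<in> T" "t \<in> T" for s t
    using that openT has_real_derivative_along_line[of f z s w] d1
    by (intro convex_on_imp_above_tangent[OF convexg convex_connected[OF convexT]])
       (auto simp: interior_open T_def intro: has_field_derivative_at_within)
  have T0: "0 \<in> T" using z by (simp add: T_def)
  then obtain e where e: "e > 0" "ball 0 e \<subseteq> T" using openT openE by blast
  have "(?g' has_real_derivative fderiv2 f z w w) (at 0)"
    using has_real_derivative_fderiv_along_line[of f z 0 w] d2 by simp
  from DERIV_neg_dec_right[OF this neg]
  obtain d where d: "d > 0" "\<And>h. 0 < h \<Longrightarrow> h < d \<Longrightarrow> ?g' h < ?g' 0" by auto
  define h where "h = min d e / 2"
  have h: "0 < h" "h < d" "h \<in> T" using d e by (auto simp: h_def subset_iff)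
  have "?g' 0 * h \<le> ?g' h * h"
    using tangent[OF T0 h(3)] tangent[OF h(3) T0] by simp
  then show False using d(2)[OF h(1,2)] h(1) by simp
qed

text \<open>
  Subtracting \<open>\<mu>/2 * \<parallel>x - y\<parallel>\<^sup>2 * t\<^sup>2\<close> from the restriction of \<open>f\<close> to the segment leaves a function of
  \<open>t\<close> with nonnegative second derivative.
\<close>

lemma fderiv2_ge_imp_strong_convexity_ineq:
  fixes f :: "'a::real_normed_vector \<Rightarrow> real"
  assumes d1: "\<And>z. z \<in> closed_segment x y \<Longrightarrow> f differentiable (at z)"
    and d2: "\<And>z. z \<in> closed_segment x y \<Longrightarrow> fderiv f differentiable (at z)"
    and bound: "\<And>z. z \<in> closed_segment x y \<Longrightarrow>
      \<mu> * (norm (x - y))\<^sup>2 \<le> fderiv2 f z (x - y) (x - y)"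
    and l: "0 \<le> l" "l \<le> 1"
  shows "f (l *\<^sub>R x + (1 - l) *\<^sub>R y) + 1/2 * \<mu> * l * (1 - l) * (norm (x - y))\<^sup>2
    \<le> l * f x + (1 - l) * f y"
proof -
  define c where "c = \<mu> * (norm (x - y))\<^sup>2"
  let ?p = "\<lambda>t. y + t *\<^sub>R (x - y)"
  let ?h = "\<lambda>t. f (?p t) - c / 2 * t\<^sup>2"
  have seg: "?p t \<in> closed_segment x y" if "t \<in> {0..1}" for t
    using that by (subst closed_segment_commute)
      (auto simp: closed_segment_def algebra_simps intro!: exI[of _ t])
  have "convex_on {0..1} ?h"
  proof (rule f''_ge0_imp_convex)
    fix t :: real
    assume t: "t \<in> {0..1}"
    show "(?h has_real_derivative fderiv f (?p t) (x - y) - c * t) (at t)"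
      by (rule derivative_eq_intros has_real_derivative_along_line[OF d1[OF seg[OF t]]] refl)+ simp
    show "((\<lambda>t. fderiv f (?p t) (x - y) - c * t) has_real_derivative
        fderiv2 f (?p t) (x - y) (x - y) - c) (at t)"
      by (rule derivative_eq_intros has_real_derivative_fderiv_along_line[OF d2[OF seg[OF t]]] refl)+
        simp
    show "0 \<le> fderiv2 f (?p t) (x - y) (x - y) - c"
      using bound[OF seg[OF t]] by (simp add: c_def)
  qed simp
  from convex_onD[OF this, of l 0 1] l
  have "?h l \<le> (1 - l) * ?h 0 + l * ?h 1" by simp
  moreover have "?p l = l *\<^sub>R x + (1 - l) *\<^sub>R y" by (simp add: algebra_simps)
  ultimately show ?thesis
    by (simp add: c_def algebra_simps power2_eq_square diff_divide_distrib)
qed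

text \<open>
  The infimum of an unbounded set of reals carries no information, so the lower bound \<open>0\<close> supplied by
  \<open>convex_imp_fderiv2_nonneg\<close> is what makes \<open>\<eta>\<close> a bound for the second derivative.
\<close>

lemma eta_le_fderiv2:
  fixes b :: "'a::real_normed_vector \<Rightarrow> ereal"
  assumes nonneg: "\<And>z w. z \<in> S \<Longrightarrow> 0 \<le> fderiv2 (\<lambda>x. real_of_ereal (b x)) z w w"
    and z: "z \<in> S"
  shows "eta b S * (norm v)\<^sup>2 \<le> fderiv2 (\<lambda>x. real_of_ereal (b x)) z v v"
proof (cases "v = 0")
  case False
  let ?B = "fderiv2 (\<lambda>x. real_of_ereal (b x)) z"
  define w where "w = (1 / norm v) *\<^sub>R v"
  have w: "norm w = 1" "v = norm v *\<^sub>R w" using False by (simp_all add: w_def)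
  have "eta b S \<le> ?B w w"
    unfolding eta_def
    by (rule cInf_lower) (use nonneg z w in \<open>auto intro!: bdd_belowI[where m = 0]\<close>)
  then have "eta b S * (norm v)\<^sup>2 \<le> ?B w w * (norm v)\<^sup>2" by (intro mult_right_mono) auto
  also have "\<dots> = ?B (norm v *\<^sub>R w) (norm v *\<^sub>R w)"
    by (simp add: blinfun.scaleR_left blinfun.scaleR_right power2_eq_square)
  also have "\<dots> = ?B v v" using w(2) by simp
  finally show ?thesis .
qed simp

section \<open>Density of the interior of a convex set\<close>

text \<open>
  The open set \<open>(1 - t) x + t D'\<close>, where \<open>D'\<close> is the interior of \<open>D\<close>, lies in \<open>D\<close>.
\<close>

lemma convex_shrink_mem_interior:
  fixes D :: "'a::real_normed_vector set"
  assumes D: "convex D" and x: "x \<in> D" and u: "u \<in> interior D" and t: "0 < t" "t \<le> 1"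
  shows "(1 - t) *\<^sub>R x + t *\<^sub>R u \<in> interior D"
proof (rule interiorI)
  let ?W = "(\<lambda>v. (1 - t) *\<^sub>R x + v) ` ((*\<^sub>R) t ` interior D)"
  show "open ?W" using t by (intro open_translation open_scaling) auto
  show "(1 - t) *\<^sub>R x + t *\<^sub>R u \<in> ?W" using u by blast
  show "?W \<subseteq> D"
    using convexD_alt[OF D x, of _ t] interior_subset[of D] t by auto
qed

lemma bounded_subset_closure_interior_Int_ball:
  fixes D :: "'a::real_normed_vector set"
  assumes D: "convex D" and u: "u \<in> interior D" "norm u < R"
    and S: "S \<subseteq> D" "\<And>x. x \<in> S \<Longrightarrow> norm x < R"
  shows "S \<subseteq> closure (interior D \<inter> ball 0 R)"
proof
  fix x assume xS: "x \<in> S"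
  define t :: "nat \<Rightarrow> real" where "t n = 1 / real (Suc n)" for n
  have t: "0 < t n" "t n \<le> 1" for n by (auto simp: t_def field_simps)
  have mem: "(1 - t n) *\<^sub>R x + t n *\<^sub>R u \<in> interior D \<inter> ball 0 R" for n
    using convex_shrink_mem_interior[OF D _ u(1) t] S xS u(2)
      convexD_alt[OF convex_ball, of x 0 R u "t n"] t[of n] by (auto simp: less_imp_le)
  have "t \<longlonglongrightarrow> 0" unfolding t_def by (rule LIMSEQ_Suc[OF lim_1_over_n])
  then have "(\<lambda>n. (1 - t n) *\<^sub>R x + t n *\<^sub>R u) \<longlonglongrightarrow> (1 - 0) *\<^sub>R x + 0 *\<^sub>R u"
    by (intro tendsto_intros)
  then show "x \<in> closure (interior D \<inter> ball 0 R)"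
    using mem unfolding closure_sequential by (intro exI) auto
qed

section \<open>Strong convexity from a positive lower bound on the second derivative\<close>

theorem proposition5p1:
  fixes b :: "'a::real_normed_vector \<Rightarrow> ereal" and U :: "'a set"
  assumes nontrivial: "(UNIV :: 'a set) \<noteq> {0}"
    and proper: "\<And>x. b x \<noteq> - \<infinity>"
    and convex_b: "ereal_convex b"
    and U_def: "U = interior (eff_dom b)"
    and U_nonempty: "U \<noteq> {}"
    and cont: "continuous_on (eff_dom b) b"
    and C2: "twice_cont_fdiff_on (\<lambda>x. real_of_ereal (b x)) U"
  shows
    "(\<forall>x\<in>U. \<forall>y\<in>U. eta b (closed_segment x y) > 0 \<longrightarrow>
        strongly_convex_on_with (closed_segment x y) b (eta b (closed_segment x y)))
     \<and>
     (\<forall>S. S \<noteq> {} \<and> convex S \<and> S \<subseteq> U \<and> eta b S > 0 \<longrightarrow>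
        strongly_convex_on_with S b (eta b S) \<and>
        strongly_convex_on_with (closure S \<inter> eff_dom b) b (eta b S))
     \<and>
     ((\<forall>S. S \<noteq> {} \<and> bounded S \<and> convex S \<and> S \<subseteq> U \<longrightarrow> eta b S > 0) \<longrightarrow>
        (\<forall>S. S \<noteq> {} \<and> bounded S \<and> convex S \<and> S \<subseteq> U \<longrightarrow> strongly_convex_on S b) \<and>
        (\<forall>S. S \<noteq> {} \<and> bounded S \<and> convex S \<and> S \<subseteq> eff_dom b \<longrightarrow> strongly_convex_on S b))"
proof -
  let ?f = "\<lambda>x. real_of_ereal (b x)" and ?D = "eff_dom b"
  note convD = convex_eff_dom[OF convex_b]
  have convU: "convex U" and openU: "open U" and UD: "U \<subseteq> ?D"
    using convD interior_subset by (auto simp: U_def)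
  have d1: "?f differentiable (at x)" and d2: "fderiv ?f differentiable (at x)" if "x \<in> U" for x
    using C2 that unfolding twice_cont_fdiff_on_def by auto
  have nonneg: "0 \<le> fderiv2 ?f z w w" if "z \<in> U" for z w
    by (rule convex_imp_fderiv2_nonneg[OF openU _ d1 d2 that])
       (use convex_on_subset[OF convex_on_real_of_ereal[OF proper convex_b] UD convU] that in auto)
  have interior_case: "strongly_convex_on_with S b (eta b S)"
    if S: "S \<noteq> {}" "convex S" "S \<subseteq> U" "eta b S > 0" for S
  proof -
    have SD: "S \<subseteq> ?D" using S UD by auto
    show ?thesis
      unfolding strongly_convex_on_with_iff_real[OF proper convex_b S(1) SD]
    proof (intro conjI ballI S(4))
      fix x y and l :: real
      assume xy: "x \<in> S" "y \<in> S" and l: "l \<in> {0<..<1}"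
      have seg: "z \<in> S" if "z \<in> closed_segment x y" for z
        using closed_segment_subset[OF xy S(2)] that by auto
      show "?f (l *\<^sub>R x + (1 - l) *\<^sub>R y) + 1/2 * eta b S * l * (1 - l) * (norm (x - y))\<^sup>2
          \<le> l * ?f x + (1 - l) * ?f y"
      proof (rule fderiv2_ge_imp_strong_convexity_ineq)
        fix z assume z: "z \<in> closed_segment x y"
        show "?f differentiable (at z)" "fderiv ?f differentiable (at z)"
          using d1 d2 seg[OF z] S(3) by auto
        show "eta b S * (norm (x - y))\<^sup>2 \<le> fderiv2 ?f z (x - y) (x - y)"
          using eta_le_fderiv2[OF nonneg seg[OF z]] S(3) by blast
      qed (use l in auto)
    qed
  qed
  note closure_case = strongly_convex_on_with_closure[OF proper convex_b cont interior_case]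
  have bounded_case: "strongly_convex_on S b"
    if pos: "\<forall>S. S \<noteq> {} \<and> bounded S \<and> convex S \<and> S \<subseteq> U \<longrightarrow> eta b S > 0"
      and S: "S \<noteq> {}" "bounded S" "S \<subseteq> ?D" for S
  proof -
    obtain u where u: "u \<in> U" using U_nonempty by auto
    have "bounded (insert u S)" using S by simp
    then obtain R where R: "\<And>x. x \<in> insert u S \<Longrightarrow> norm x < R"
      unfolding bounded_pos_less by blast
    let ?V = "U \<inter> ball 0 R"
    have V: "?V \<noteq> {}" "convex ?V" "?V \<subseteq> U" "bounded ?V"
      using u R convU bounded_subset[OF bounded_ball, of ?V 0 R] by (auto intro: convex_Int)
    have "S \<subseteq> closure ?V \<inter> ?D"
      using bounded_subset_closure_interior_Int_ball[OF convD, of u R S] u R S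
      unfolding U_def by auto
    with closure_case[OF V(1-3)] pos V S(1) show ?thesis
      unfolding strongly_convex_on_def by (blast intro: strongly_convex_on_with_subset)
  qed
  have segment_case: "strongly_convex_on_with (closed_segment x y) b (eta b (closed_segment x y))"
    if "x \<in> U" "y \<in> U" "eta b (closed_segment x y) > 0" for x y
    using that by (intro interior_case closed_segment_subset convU) auto
  show ?thesis
  proof (intro conjI)
    show "\<forall>x\<in>U. \<forall>y\<in>U. eta b (closed_segment x y) > 0 \<longrightarrow>
        strongly_convex_on_with (closed_segment x y) b (eta b (closed_segment x y))"
      using segment_case by blast
    show "\<forall>S. S \<noteq> {} \<and> convex S \<and> S \<subseteq> U \<and> eta b S > 0 \<longrightarrow>
        strongly_convex_on_with S b (eta b S) \<and>
        strongly_convex_on_with (closure S \<inter> eff_dom b) b (eta b S)"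
      using interior_case closure_case by simp
    show "(\<forall>S. S \<noteq> {} \<and> bounded S \<and> convex S \<and> S \<subseteq> U \<longrightarrow> eta b S > 0) \<longrightarrow>
        (\<forall>S. S \<noteq> {} \<and> bounded S \<and> convex S \<and> S \<subseteq> U \<longrightarrow> strongly_convex_on S b) \<and>
        (\<forall>S. S \<noteq> {} \<and> bounded S \<and> convex S \<and> S \<subseteq> eff_dom b \<longrightarrow> strongly_convex_on S b)"
      using bounded_case UD by (meson subset_trans)
  qed
qed

end
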